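(* Let $M$ be a finite-state transducer and $x$ an eventually recurrent sequence over its input alphabet such that $M(x)$ is infinite. Then $M(x)$ is eventually recurrent.
   Context: Sequences over a finite alphabet $A$ are maps $\mathbb{N}\to A$. A sequence is recurrent if every finite word occurring in it occurs infinitely many times; it is eventually recurrent if some suffix $x(k)x(k+1)\dots$ is recurrent. A finite-state transducer is $M=\langle A,B,Q,\tilde q,\lambda,\mu\rangle$ with finite alphabets $A,B$, finite state set $Q$, initial state $\tilde q$, $\lambda\colon Q\times A\to B^*$, $\mu\colon Q\times A\to Q$. Its run on $x$ is $p_0=\tilde q$, $p_{n+1}=\mu(p_n,x(n))$, and $M(x)=\lambda(p_0,x(0))\lambda(p_1,x(1))\dots$ (concatenation). *)

theory Defs
  imports "HOL-Library.Omega_Words_Fun"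
begin

definition occurs_at :: "'a list \<Rightarrow> 'a word \<Rightarrow> nat \<Rightarrow> bool"
  where "occurs_at u x i \<longleftrightarrow> x [i \<rightarrow> i + length u] = u"

definition recurrent :: "'a word \<Rightarrow> bool"
  where "recurrent x \<longleftrightarrow> (\<forall>u. (\<exists>i. occurs_at u x i) \<longrightarrow> infinite {i. occurs_at u x i})"

definition eventually_recurrent :: "'a word \<Rightarrow> bool"
  where "eventually_recurrent x \<longleftrightarrow> (\<exists>k. recurrent (suffix k x))"

record ('a, 'b, 'q) transducer =
  in_alphabet :: "'a set"
  out_alphabet :: "'b set"
  states :: "'q set"
  initial :: "'q"
  output_fun :: "'q \<Rightarrow> 'a \<Rightarrow> 'b list"
  next_state :: "'q \<Rightarrow> 'a \<Rightarrow> 'q"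

definition finite_state_transducer :: "('a, 'b, 'q) transducer \<Rightarrow> bool"
  where "finite_state_transducer M \<longleftrightarrow>
    finite (in_alphabet M) \<and> finite (out_alphabet M) \<and> finite (states M) \<and>
    initial M \<in> states M \<and>
    (\<forall>q \<in> states M. \<forall>a \<in> in_alphabet M.
       output_fun M q a \<in> lists (out_alphabet M) \<and> next_state M q a \<in> states M)"

primrec run :: "('a, 'b, 'q) transducer \<Rightarrow> 'a word \<Rightarrow> nat \<Rightarrow> 'q"
  where
    "run M x 0 = initial M"
  | "run M x (Suc n) = next_state M (run M x n) (x n)"

definition partial_output :: "('a, 'b, 'q) transducer \<Rightarrow> 'a word \<Rightarrow> nat \<Rightarrow> 'b list"
  where "partial_output M x n = concat (map (\<lambda>i. output_fun M (run M x i) (x i)) [0..<n])"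

definition infinite_output :: "('a, 'b, 'q) transducer \<Rightarrow> 'a word \<Rightarrow> bool"
  where "infinite_output M x \<longleftrightarrow> (\<forall>m. \<exists>n. m < length (partial_output M x n))"

text \<open>
  The concatenation of all the output words, as a sequence. Its value is meaningful
  only if the output is infinite; it is then the unique sequence that has every
  partial output as a prefix.
\<close>

definition output_word :: "('a, 'b, 'q) transducer \<Rightarrow> 'a word \<Rightarrow> 'b word"
  where "output_word M x m =
    partial_output M x (LEAST n. m < length (partial_output M x n)) ! m"

lemma partial_output_mono:
  assumes "n \<le> n'"
  shows "\<exists>v. partial_output M x n' = partial_output M x n @ v"
proof -
  have "[0..<n'] = [0..<n] @ [n..<n']"
    using assms by (metis le_add_diff_inverse upt_add_eq_append zero_le)
  then show ?thesis
    by (simp add: partial_output_def)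
qed

lemma prefix_output_word:
  "prefix (length (partial_output M x n)) (output_word M x) = partial_output M x n"
proof (rule nth_equalityI)
  fix m
  assume "m < length (prefix (length (partial_output M x n)) (output_word M x))"
  then have m: "m < length (partial_output M x n)"
    by simp
  define l where "l = (LEAST n. m < length (partial_output M x n))"
  have l: "m < length (partial_output M x l)" "l \<le> n"
    unfolding l_def by (rule LeastI[of _ n], rule m, rule Least_le, rule m)
  obtain v where "partial_output M x n = partial_output M x l @ v"
    using partial_output_mono[OF l(2)] by blast
  then have "partial_output M x l ! m = partial_output M x n ! m"
    using l(1) by (simp add: nth_append)
  then show "prefix (length (partial_output M x n)) (output_word M x) ! m = partial_output M x n ! m"
    using m by (simp add: output_word_def l_def)
qed simp

lemma output_word_unique:
  assumes "infinite_output M x"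
    and "\<And>n. prefix (length (partial_output M x n)) y = partial_output M x n"
  shows "y = output_word M x"
proof
  fix m
  obtain n where "m < length (partial_output M x n)"
    using assms(1) by (auto simp: infinite_output_def)
  then have "y m = partial_output M x n ! m \<and> output_word M x m = partial_output M x n ! m"
    using assms(2)[of n] prefix_output_word[of M x n]
    by (metis add_0 diff_zero subsequence_nth)
  then show "y m = output_word M x m"
    by simp
qed

end

theory Submission
  imports Defs
begin

text \<open>
  Colour each position of the input by the state of the run there. For a factor \<open>v\<close> of the
  recurrent part of the input, let \<open>S(v)\<close> be the set of colours of infinitely many occurrences
  of \<open>v\<close>. It is nonempty and can only shrink when \<open>v\<close> is extended to the right. If \<open>S(v)\<close> has
  the least possible size, it never shrinks; hence at an occurrence of \<open>v\<close> whose colour lies in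
  \<open>S(v)\<close>, every factor that starts there recurs infinitely often together with that colour.
  Equal state and equal input force equal output, so the output is recurrent from there on.
\<close>

lemma occurs_at_iff_nth: "occurs_at u x i \<longleftrightarrow> (\<forall>j<length u. x (i + j) = u ! j)"
proof -
  have "occurs_at u x i \<longleftrightarrow> (\<forall>j<length u. x [i \<rightarrow> i + length u] ! j = u ! j)"
    unfolding occurs_at_def by (subst list_eq_iff_nth_eq) simp
  then show ?thesis
    by simp
qed

text \<open>Prefixes suffice: an occurrence of \<open>u\<close> at \<open>i\<close> lies inside the
  prefix of length \<open>i + length u\<close>, so each copy of that prefix carries \<open>u\<close>
  along.\<close>

lemma recurrentI:
  assumes "\<And>n N. \<exists>m\<ge>N. \<forall>j<n. x (m + j) = x j"
  shows "recurrent x"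
  unfolding recurrent_def
proof (intro allI impI)
  fix u
  assume "\<exists>i. occurs_at u x i"
  then obtain i where i: "occurs_at u x i" ..
  have "\<exists>m\<ge>N. occurs_at u x m" for N
  proof -
    obtain m where m: "m \<ge> N" "\<forall>j<i + length u. x (m + j) = x j"
      using assms by blast
    then have "occurs_at u x (m + i)"
      using i by (simp add: occurs_at_iff_nth add.assoc)
    then show ?thesis
      using m(1) trans_le_add1 by blast
  qed
  then show "infinite {m. occurs_at u x m}"
    by (auto simp: infinite_nat_iff_unbounded_le)
qed

lemma recurrent_suffix_INFM:
  assumes "recurrent (suffix k x)" and "k \<le> i"
  shows "\<exists>\<^sub>\<infinity>m. \<forall>j<n. x (m + j) = x (i + j)"
  unfolding INFM_nat_le
proof
  fix N
  define u where "u = map (\<lambda>j. x (i + j)) [0..<n]"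
  have "occurs_at u (suffix k x) (i - k)"
    using assms(2) by (simp add: occurs_at_iff_nth u_def)
  then have "infinite {m. occurs_at u (suffix k x) m}"
    using assms(1) by (auto simp: recurrent_def)
  then obtain m where "m \<ge> N" "occurs_at u (suffix k x) m"
    by (auto simp: infinite_nat_iff_unbounded_le)
  then have "k + m \<ge> N \<and> (\<forall>j<n. x (k + m + j) = x (i + j))"
    by (simp add: occurs_at_iff_nth u_def add.assoc)
  then show "\<exists>m\<ge>N. \<forall>j<n. x (m + j) = x (i + j)" ..
qed

lemma recurrent_coloured_position:
  fixes c :: "nat \<Rightarrow> 'q"
  assumes rec: "recurrent (suffix k x)" and fin: "finite (range c)"
  shows "\<exists>i. \<forall>n. \<exists>\<^sub>\<infinity>m. (\<forall>j<n. x (m + j) = x (i + j)) \<and> c m = c i"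
proof -
  \<comment> \<open>The pair \<open>(i, n)\<close> stands for the factor of length \<open>n\<close>
    at position \<open>i\<close>.\<close>
  define S where
    "S = (\<lambda>(i, n). {q \<in> range c. \<exists>\<^sub>\<infinity>m. (\<forall>j<n. x (m + j) = x (i + j)) \<and> c m = q})"
  have "\<exists>p. k \<le> fst p \<and> (\<forall>p'. k \<le> fst p' \<longrightarrow> card (S p) \<le> card (S p'))"
    by (rule ex_has_least_nat[of _ "(k, 0)"]) simp
  then obtain i n where "k \<le> i"
    and least: "\<And>i' n'. k \<le> i' \<Longrightarrow> card (S (i, n)) \<le> card (S (i', n'))"
    unfolding split_paired_Ex split_paired_All fst_conv by blast
  define A where "A = {m. \<forall>j<n. x (m + j) = x (i + j)}"
  have "infinite A"
    using recurrent_suffix_INFM[OF rec \<open>k \<le> i\<close>] by (simp add: A_def INFM_iff_infinite)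
  moreover have "finite (c ` A)"
    using fin by (rule finite_subset[rotated]) auto
  ultimately obtain m0 where "infinite {m \<in> A. c m = c m0}"
    using pigeonhole_infinite by blast
  then have m0: "\<exists>\<^sub>\<infinity>m. m \<in> A \<and> c m = c m0"
    by (simp add: INFM_iff_infinite)
  \<comment> \<open>The pigeonhole representative \<open>m0\<close> may lie before \<open>k\<close>,
    where minimality says nothing; a later position of the same colour replaces it.\<close>
  then obtain m where m: "m \<ge> k" "m \<in> A" "c m = c m0"
    unfolding INFM_nat_le by blast
  have cm: "c m \<in> S (i, n)"
    using m0 m(3) by (simp add: S_def A_def)
  have "\<exists>\<^sub>\<infinity>m'. (\<forall>j<l. x (m' + j) = x (m + j)) \<and> c m' = c m" for l
  proof -
    \<comment> \<open>Length at least \<open>n\<close> makes the factor at \<open>m\<close> an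
      extension of the one at \<open>i\<close>, since \<open>m\<close> is in \<open>A\<close>;
      length at least \<open>l\<close> covers the factor to be repeated.\<close>
    have "S (m, max n l) \<subseteq> S (i, n)"
    proof
      fix q
      assume "q \<in> S (m, max n l)"
      then have "q \<in> range c"
        and "\<exists>\<^sub>\<infinity>m'. (\<forall>j<max n l. x (m' + j) = x (m + j)) \<and> c m' = q"
        by (simp_all add: S_def)
      moreover from this(2) have "\<exists>\<^sub>\<infinity>m'. (\<forall>j<n. x (m' + j) = x (i + j)) \<and> c m' = q"
        by (rule INFM_mono) (use m(2) in \<open>simp add: A_def\<close>)
      ultimately show "q \<in> S (i, n)"
        by (simp add: S_def)
    qed
    moreover have "card (S (i, n)) \<le> card (S (m, max n l))"
      using m(1) by (rule least)
    moreover have "finite (S (i, n))"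
      using fin by (simp add: S_def)
    ultimately have "S (m, max n l) = S (i, n)"
      by (meson card_seteq)
    then have "c m \<in> S (m, max n l)"
      using cm by simp
    then have "\<exists>\<^sub>\<infinity>m'. (\<forall>j<max n l. x (m' + j) = x (m + j)) \<and> c m' = c m"
      by (simp add: S_def)
    then show ?thesis
      by (rule INFM_mono) simp
  qed
  then show ?thesis
    by blast
qed

lemma finite_range_run:
  assumes "finite_state_transducer M" and "range x \<subseteq> in_alphabet M"
  shows "finite (range (run M x))"
proof -
  have "run M x n \<in> states M" for n
    using assms by (induction n) (auto simp: finite_state_transducer_def)
  then show ?thesis
    using assms(1) by (auto simp: finite_state_transducer_def intro: finite_subset)
qed

text \<open>The state at offset \<open>j\<close> depends only on the letters at smaller offsets, so
  \<open>j = n\<close> is still allowed.\<close>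

lemma run_add_eq:
  assumes "\<forall>j<n. x (m + j) = x (i + j)" and "run M x m = run M x i" and "j \<le> n"
  shows "run M x (m + j) = run M x (i + j)"
  using assms(3) by (induction j) (use assms(1,2) in auto)

definition output_block :: "('a, 'b, 'q) transducer \<Rightarrow> 'a word \<Rightarrow> nat \<Rightarrow> nat \<Rightarrow> 'b list"
  where "output_block M x i n =
    concat (map (\<lambda>j. output_fun M (run M x (i + j)) (x (i + j))) [0..<n])"

lemma output_block_eq:
  assumes "\<forall>j<n. x (m + j) = x (i + j)" and "run M x m = run M x i"
  shows "output_block M x m n = output_block M x i n"
  unfolding output_block_def using assms run_add_eq[OF assms]
  by (intro arg_cong[where f = concat] map_cong) auto

lemma partial_output_add:
  "partial_output M x (i + n) = partial_output M x i @ output_block M x i n"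
  by (induction n) (simp_all add: partial_output_def output_block_def)

text \<open>Every partial output is a prefix of the output word, so the letter can be read off after
  \<open>i + n\<close> steps.\<close>

lemma output_word_nth_block:
  assumes "j < length (output_block M x i n)"
  shows "output_word M x (length (partial_output M x i) + j) = output_block M x i n ! j"
proof -
  let ?k = "length (partial_output M x i) + j"
  have k: "?k < length (partial_output M x (i + n))"
    using assms by (simp add: partial_output_add)
  then have "output_word M x ?k = prefix (length (partial_output M x (i + n))) (output_word M x) ! ?k"
    by simp
  also have "\<dots> = partial_output M x (i + n) ! ?k"
    by (simp only: prefix_output_word)
  also have "\<dots> = output_block M x i n ! j"
    by (simp add: partial_output_add nth_append)
  finally show ?thesis .
qed

lemma length_partial_output_mono:
  "n \<le> n' \<Longrightarrow> length (partial_output M x n) \<le> length (partial_output M x n')"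
  using partial_output_mono[of n n' M x] by auto

theorem theorem10:
  fixes M :: "('a, 'b, 'q) transducer" and x :: "'a word"
  assumes "finite_state_transducer M"
    and "range x \<subseteq> in_alphabet M"
    and "eventually_recurrent x"
    and "infinite_output M x"
  shows "eventually_recurrent (output_word M x)"
proof -
  let ?L = "\<lambda>n. length (partial_output M x n)"
  obtain k where "recurrent (suffix k x)"
    using assms(3) by (auto simp: eventually_recurrent_def)
  then obtain i where
    i: "\<And>n. \<exists>\<^sub>\<infinity>m. (\<forall>j<n. x (m + j) = x (i + j)) \<and> run M x m = run M x i"
    using recurrent_coloured_position finite_range_run[OF assms(1,2)] by blast
  have "recurrent (suffix (?L i) (output_word M x))"
  proof (rule recurrentI)
    fix l N
    \<comment> \<open>Chosen so that reading \<open>n\<close> letters from position \<open>i\<close>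
      emits more than \<open>l\<close> output letters.\<close>
    obtain n where "?L i + l < ?L n"
      using assms(4) by (auto simp: infinite_output_def)
    then have "?L i + l < ?L (i + n)"
      using length_partial_output_mono[of n "i + n" M x] by simp
    then have l: "l < length (output_block M x i n)"
      by (simp add: partial_output_add)
    \<comment> \<open>From \<open>n0\<close> on, more than \<open>N\<close> letters have been
      emitted beyond \<open>?L i\<close>, so the offset \<open>?L m - ?L i\<close> used as witness
      below exceeds \<open>N\<close> and the subtraction does not truncate.\<close>
    obtain n0 where n0: "?L i + N < ?L n0"
      using assms(4) by (auto simp: infinite_output_def)
    obtain m where m: "m \<ge> n0" "\<forall>j<n. x (m + j) = x (i + j)" "run M x m = run M x i"
      using i[of n] by (auto simp: INFM_nat_le)
    have block: "output_block M x m n = output_block M x i n"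
      using m(2,3) by (rule output_block_eq)
    have Lm: "?L i + N < ?L m"
      using n0 length_partial_output_mono[OF m(1), of M x] by simp
    have "output_word M x (?L m + j) = output_word M x (?L i + j)" if "j < l" for j
      using that l by (simp add: output_word_nth_block[where n = n] block)
    then show "\<exists>m\<ge>N. \<forall>j<l. suffix (?L i) (output_word M x) (m + j) =
        suffix (?L i) (output_word M x) j"
      using Lm by (intro exI[of _ "?L m - ?L i"]) (auto simp: add.assoc[symmetric])
  qed
  then show ?thesis
    by (auto simp: eventually_recurrent_def)
qed

end
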